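(* Let $L/K$ be a field extension, let $f_1,\ldots,f_n\in L$ be nonzero, and let $T=K[f_1,\ldots,f_n]$. Then $R(T)\left[\prod_{i=1}^n f_i\right]=\operatorname{Frac}T$. Hence $1/\prod_{i=1}^n f_i\in\mathfrak p$ for every nonzero prime ideal $\mathfrak p$ of $R(T)$.
   Context: For an integral domain $T$ with fraction field $\operatorname{Frac}T$, the reciprocal complement $R(T)$ is the subring of $\operatorname{Frac}T$ generated by all $1/f$ with $f\in T\setminus\{0\}$. $K[f_1,\ldots,f_n]$ denotes the $K$-subalgebra of $L$ generated by $f_1,\ldots,f_n$, and $R(T)[g]$ denotes the subring of $\operatorname{Frac}T$ generated by $R(T)$ and $g$. *)

theory Defs
  imports "HOL-Algebra.Algebra"
begin

text \<open>
  All rings live inside an ambient field \<open>L\<close>. The predicate \<open>subalgebra K V L\<close> of HOL-Algebra only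
  says that \<open>V\<close> is an additive subgroup closed under scaling by \<open>K\<close>; unital \<open>K\<close>-subalgebras in the
  ring-theoretic sense are obtained by adding \<open>subring V L\<close>.
\<close>

definition adjoin_algebra :: "('a, 'm) ring_scheme \<Rightarrow> 'a set \<Rightarrow> 'a set \<Rightarrow> 'a set" where
  "adjoin_algebra L K S = \<Inter> {V. subring V L \<and> subalgebra K V L \<and> S \<subseteq> V}"

text \<open>
  The fraction field of a subring \<open>T\<close> of the field \<open>L\<close>, realised inside \<open>L\<close>.
\<close>

definition frac_field :: "('a, 'm) ring_scheme \<Rightarrow> 'a set \<Rightarrow> ('a, 'm) ring_scheme" where
  "frac_field L T =
     L\<lparr>carrier := {a \<otimes>\<^bsub>L\<^esub> inv\<^bsub>L\<^esub> b | a b. a \<in> T \<and> b \<in> T - {\<zero>\<^bsub>L\<^esub>}}\<rparr>"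

definition reciprocal_complement :: "('a, 'm) ring_scheme \<Rightarrow> 'a set \<Rightarrow> 'a set" where
  "reciprocal_complement L T =
     generate_ring (frac_field L T) {inv\<^bsub>L\<^esub> f | f. f \<in> T - {\<zero>\<^bsub>L\<^esub>}}"

end

theory Submission
  imports Defs
begin

text \<open>
  Write \<open>P\<close> for the product of the \<open>f i\<close> and \<open>R\<close> for the reciprocal complement of \<open>T\<close>. The whole
  result says that \<open>Frac T\<close> is obtained from \<open>R\<close> by inverting the single element \<open>inv P\<close>: every
  element of \<open>Frac T\<close> is moved into \<open>R\<close> by a high enough power of \<open>inv P\<close>
  (\<open>frac_field_mult_power_in_reciprocal_complement\<close>).

  To see this, consider all \<open>a\<close> such that \<open>a \<otimes> (inv P)^N\<close> lies in \<open>R\<close> for some \<open>N\<close>. They form a ring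
  (\<open>localization_is_subring\<close>). The ring contains \<open>K\<close>, because a nonzero \<open>k\<close> is the reciprocal of
  \<open>inv k\<close>. It contains each \<open>f i\<close>, because \<open>f i \<otimes> inv P\<close> is the reciprocal of the product of the
  other generators. Hence it contains \<open>T\<close>, and, since it contains all reciprocals of elements of \<open>T\<close>,
  it contains \<open>Frac T\<close>.

  Both claims follow. Multiplying \<open>a \<otimes> (inv P)^N\<close> by \<open>P^N\<close> writes \<open>a\<close> as an element of \<open>R[P]\<close>. If
  \<open>x\<close> is a nonzero element of a prime ideal, then applying the fact to \<open>inv x\<close> shows that \<open>x\<close> divides
  a power of \<open>inv P\<close> in \<open>R\<close>, so that the prime ideal contains \<open>inv P\<close>
  (\<open>primeideal_contains_divided_power\<close>).
\<close>

section \<open>Subrings and localizations\<close>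

lemma (in ring) generate_ring_in_subring:
  assumes "subring F R" "H \<subseteq> F"
  shows "subring (generate_ring (R\<lparr>carrier := F\<rparr>) H) R"
    and "generate_ring (R\<lparr>carrier := F\<rparr>) H \<subseteq> F"
proof -
  interpret F: ring "R\<lparr>carrier := F\<rparr>"
    using subring_is_ring[OF assms(1)] .
  show incl: "generate_ring (R\<lparr>carrier := F\<rparr>) H \<subseteq> F"
    using F.generate_ring_incl[of H] assms(2) by simp
  show "subring (generate_ring (R\<lparr>carrier := F\<rparr>) H) R"
    using ring_incl_imp_subring[of "generate_ring (R\<lparr>carrier := F\<rparr>) H"]
      F.generate_ring_is_ring[of H] incl assms subringE(1)[OF assms(1)] by auto
qed

lemma (in ring) subring_nat_pow_closed:
  assumes "subring A R" "a \<in> A"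
  shows "a [^] (n::nat) \<in> A"
  by (induction n) (use assms subringE(3,6)[OF assms(1)] in auto)

lemma (in cring) subring_finprod_closed:
  assumes "subring A R" "finite I" "\<And>i. i \<in> I \<Longrightarrow> f i \<in> A"
  shows "finprod R f I \<in> A"
  using assms(2,3)
proof (induction I)
  case empty
  then show ?case using subringE(3)[OF assms(1)] by simp
next
  case (insert i I)
  have "f \<in> insert i I \<rightarrow> carrier R"
    using insert.prems subringE(1)[OF assms(1)] by auto
  then show ?case
    using insert subringE(6)[OF assms(1)] by auto
qed

lemma (in domain) finprod_nonzero:
  assumes "finite I" "\<And>i. i \<in> I \<Longrightarrow> f i \<in> carrier R - {\<zero>}"
  shows "finprod R f I \<noteq> \<zero>"
  using assms
proof (induction I)
  case empty
  then show ?case by simp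
next
  case (insert i I)
  then have "f \<in> I \<rightarrow> carrier R" "f i \<in> carrier R - {\<zero>}" by auto
  then show ?case
    using insert integral[of "f i" "finprod R f I"] by auto
qed

lemma (in field) inv_nonzero:
  assumes "a \<in> carrier R" "a \<noteq> \<zero>"
  shows "inv a \<in> carrier R" "inv a \<noteq> \<zero>" "a \<otimes> inv a = \<one>" "inv a \<otimes> a = \<one>" "inv (inv a) = a"
  using subfield_m_inv[OF carrier_is_subfield, of a] assms field_Units Units_inv_inv[of a] by auto

lemma (in field) inv_mult_nonzero:
  assumes "a \<in> carrier R" "a \<noteq> \<zero>" "b \<in> carrier R" "b \<noteq> \<zero>"
  shows "inv (a \<otimes> b) = inv a \<otimes> inv b"
proof (rule comm_inv_char)
  note ia = inv_nonzero[OF assms(1,2)] and ib = inv_nonzero[OF assms(3,4)]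
  show "a \<otimes> b \<in> carrier R" "inv a \<otimes> inv b \<in> carrier R" using assms ia ib by auto
  have "(a \<otimes> b) \<otimes> (inv a \<otimes> inv b) = (a \<otimes> inv a) \<otimes> (b \<otimes> inv b)"
    using assms ia(1) ib(1) by (simp add: m_ac)
  then show "(a \<otimes> b) \<otimes> (inv a \<otimes> inv b) = \<one>"
    using ia ib by simp
qed

text \<open>
  If \<open>g\<close> is invertible, the subring below is the localization of \<open>A\<close> at the powers of \<open>g\<close>. Phrasing
  it through \<open>a \<otimes> g^N\<close> keeps the argument free of fractions: two elements are brought to a common
  denominator by adding the exponents.
\<close>

lemma (in cring) localization_is_subring:
  assumes A: "subring A R" and g: "g \<in> A"
  shows "subring {a \<in> carrier R. \<exists>N::nat. a \<otimes> g [^] N \<in> A} R" (is "subring ?S R")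
proof (rule subringI)
  note AE = subringE[OF A]
  have gc: "g \<in> carrier R" using AE(1) g by auto
  have pow: "g [^] (N::nat) \<in> A" for N by (rule subring_nat_pow_closed[OF A g])
  show "?S \<subseteq> carrier R" by auto
  have "\<one> \<otimes> g [^] (0::nat) \<in> A" using AE(3) by simp
  then show "\<one> \<in> ?S" by blast
  fix a assume "a \<in> ?S"
  then obtain M :: nat where a: "a \<in> carrier R" "a \<otimes> g [^] M \<in> A" by auto
  have "\<ominus> a \<otimes> g [^] M \<in> A"
    using AE(5)[OF a(2)] a(1) gc by (simp add: l_minus)
  then show "\<ominus> a \<in> ?S" using a(1) by auto
  fix b assume "b \<in> ?S"
  then obtain N :: nat where b: "b \<in> carrier R" "b \<otimes> g [^] N \<in> A" by auto
  have "(a \<otimes> b) \<otimes> g [^] (M + N) = (a \<otimes> g [^] M) \<otimes> (b \<otimes> g [^] N)"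
    using a(1) b(1) gc by (simp add: nat_pow_mult[symmetric] m_ac)
  then have "(a \<otimes> b) \<otimes> g [^] (M + N) \<in> A" using AE(6)[OF a(2) b(2)] by simp
  then show "a \<otimes> b \<in> ?S" using a(1) b(1) by blast
  have "(a \<oplus> b) \<otimes> g [^] (M + N) = (a \<otimes> g [^] M) \<otimes> g [^] N \<oplus> (b \<otimes> g [^] N) \<otimes> g [^] M"
    using a(1) b(1) gc by (simp add: nat_pow_mult[symmetric] l_distr r_distr m_ac)
  then have "(a \<oplus> b) \<otimes> g [^] (M + N) \<in> A"
    using AE(6)[OF a(2) pow] AE(6)[OF b(2) pow] AE(7) by simp
  then show "a \<oplus> b \<in> ?S" using a(1) b(1) by blast
qed

text \<open>
  The hypothesis on \<open>inv x\<close> says that \<open>x\<close> divides a power of \<open>g\<close> within \<open>A\<close>. The exponent may be \<open>0\<close>: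
  then \<open>x\<close> would be a unit of \<open>A\<close>, which a proper ideal cannot contain.
\<close>

lemma (in field) primeideal_contains_divided_power:
  assumes A: "subring A R" and p: "primeideal p (R\<lparr>carrier := A\<rparr>)"
    and x: "x \<in> p" "x \<noteq> \<zero>" and g: "g \<in> A" and q: "inv x \<otimes> g [^] (N::nat) \<in> A"
  shows "g \<in> p"
proof -
  interpret p: primeideal p "R\<lparr>carrier := A\<rparr>" by (rule p)
  have xc: "x \<in> carrier R" and gc: "g \<in> carrier R"
    using p.a_subset x(1) subringE(1)[OF A] g by auto
  note ix = inv_nonzero[OF xc x(2)]
  have "x \<otimes> (inv x \<otimes> g [^] N) \<in> p"
    using p.I_r_closed[OF x(1)] q by simp
  moreover have "x \<otimes> (inv x \<otimes> g [^] N) = g [^] N"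
    using xc ix gc by (simp add: m_assoc[symmetric])
  ultimately have "g [^] N \<in> p" by simp
  then show ?thesis
  proof (induction N)
    case 0
    then have "\<one>\<^bsub>R\<lparr>carrier := A\<rparr>\<^esub> \<in> p" by simp
    then show ?case using p.one_imp_carrier p.I_notcarr by simp
  next
    case (Suc N)
    have "g [^] N \<in> A" by (rule subring_nat_pow_closed[OF A g])
    then show ?case using Suc p.I_prime[of "g [^] N" g] g by auto
  qed
qed

section \<open>Fraction field and reciprocal complement\<close>

text \<open>
  In this form, facts about generated subrings of a subring \<open>F\<close> of the ambient field apply to
  \<open>frac_field L T\<close>, and all computations can be made with the operations of \<open>L\<close>.
\<close>

lemma frac_field_eq: "frac_field L T = L\<lparr>carrier := carrier (frac_field L T)\<rparr>"
  by (simp add: frac_field_def)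

lemma frac_field_carrier_iff:
  "x \<in> carrier (frac_field L T) \<longleftrightarrow>
    (\<exists>a b. a \<in> T \<and> b \<in> T \<and> b \<noteq> \<zero>\<^bsub>L\<^esub> \<and> x = a \<otimes>\<^bsub>L\<^esub> inv\<^bsub>L\<^esub> b)"
  by (auto simp: frac_field_def)

lemma frac_field_memI:
  "a \<in> T \<Longrightarrow> b \<in> T \<Longrightarrow> b \<noteq> \<zero>\<^bsub>L\<^esub> \<Longrightarrow> a \<otimes>\<^bsub>L\<^esub> inv\<^bsub>L\<^esub> b \<in> carrier (frac_field L T)"
  by (auto simp: frac_field_def)

lemma (in field) frac_field_subring:
  assumes T: "subring T R"
  shows "subring (carrier (frac_field R T)) R"
proof (rule subringI)
  note TE = subringE[OF T]
  show "carrier (frac_field R T) \<subseteq> carrier R"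
    using TE(1) by (auto simp: frac_field_carrier_iff subset_iff inv_nonzero)
  show "\<one> \<in> carrier (frac_field R T)"
    using frac_field_memI[of \<one> T \<one> R] TE(3) by simp
  fix x assume "x \<in> carrier (frac_field R T)"
  then obtain a b where x: "a \<in> T" "b \<in> T" "b \<noteq> \<zero>" "x = a \<otimes> inv b"
    by (auto simp: frac_field_carrier_iff)
  have c1: "a \<in> carrier R" "b \<in> carrier R" using x TE(1) by auto
  note ib = inv_nonzero[OF c1(2) x(3)]
  have "\<ominus> x = (\<ominus> a) \<otimes> inv b" using x c1 ib by (simp add: l_minus)
  then show "\<ominus> x \<in> carrier (frac_field R T)"
    using frac_field_memI[of "\<ominus> a" T b R] TE(5) x by simp
  fix y assume "y \<in> carrier (frac_field R T)"
  then obtain c d where y: "c \<in> T" "d \<in> T" "d \<noteq> \<zero>" "y = c \<otimes> inv d"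
    by (auto simp: frac_field_carrier_iff)
  have c2: "c \<in> carrier R" "d \<in> carrier R" using y TE(1) by auto
  note id = inv_nonzero[OF c2(2) y(3)]
  have bd: "b \<otimes> d \<in> T" "b \<otimes> d \<noteq> \<zero>" "inv (b \<otimes> d) = inv b \<otimes> inv d"
    using TE(6) x y c1 c2 integral[of b d] inv_mult_nonzero by auto
  have "x \<otimes> y = (a \<otimes> c) \<otimes> inv (b \<otimes> d)"
    using x y c1 c2 ib id bd by (simp add: m_ac)
  then show "x \<otimes> y \<in> carrier (frac_field R T)"
    using frac_field_memI[of "a \<otimes> c" T "b \<otimes> d" R] TE(6) bd(1,2) x(1) y(1) by simp
  have "(a \<otimes> d) \<otimes> inv (b \<otimes> d) = x \<otimes> (d \<otimes> inv d)"
    using x y c1 c2 ib(1) id(1) bd by (simp add: m_ac)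
  moreover have "(c \<otimes> b) \<otimes> inv (b \<otimes> d) = y \<otimes> (b \<otimes> inv b)"
    using x y c1 c2 ib(1) id(1) bd by (simp add: m_ac)
  ultimately have "x \<oplus> y = (a \<otimes> d \<oplus> c \<otimes> b) \<otimes> inv (b \<otimes> d)"
    using x y c1 c2 ib id bd by (simp add: l_distr)
  then show "x \<oplus> y \<in> carrier (frac_field R T)"
    using frac_field_memI[of "a \<otimes> d \<oplus> c \<otimes> b" T "b \<otimes> d" R] TE(6,7) bd(1,2) x(1,2) y(1,2) by simp
qed

lemma (in field) subset_frac_field:
  assumes T: "subring T R"
  shows "T \<subseteq> carrier (frac_field R T)"
proof
  fix a assume a: "a \<in> T"
  then have "a \<otimes> inv \<one> = a" using subringE(1)[OF T] by auto
  then show "a \<in> carrier (frac_field R T)"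
    using frac_field_memI[of a T \<one> R] a subringE(3)[OF T] by simp
qed

lemma (in field) inv_in_frac_field:
  assumes T: "subring T R" and "t \<in> T" "t \<noteq> \<zero>"
  shows "inv t \<in> carrier (frac_field R T)"
proof -
  have "\<one> \<otimes> inv t = inv t" using assms subringE(1)[OF T] inv_nonzero(1)[of t] by auto
  then show ?thesis using frac_field_memI[of \<one> T t R] assms subringE(3)[OF T] by simp
qed

lemma (in field) reciprocal_complement_subring:
  assumes T: "subring T R"
  shows "subring (reciprocal_complement R T) R"
    and "reciprocal_complement R T \<subseteq> carrier (frac_field R T)"
proof -
  let ?H = "{inv f | f. f \<in> T - {\<zero>}}"
  have "?H \<subseteq> carrier (frac_field R T)" using inv_in_frac_field[OF T] by auto
  note gen = generate_ring_in_subring[OF frac_field_subring[OF T] this]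
  have eq: "reciprocal_complement R T
      = generate_ring (R\<lparr>carrier := carrier (frac_field R T)\<rparr>) ?H"
    unfolding reciprocal_complement_def by (subst frac_field_eq) (rule refl)
  show "subring (reciprocal_complement R T) R"
    "reciprocal_complement R T \<subseteq> carrier (frac_field R T)"
    unfolding eq using gen by auto
qed

lemma inv_in_reciprocal_complement:
  "t \<in> T \<Longrightarrow> t \<noteq> \<zero>\<^bsub>L\<^esub> \<Longrightarrow> inv\<^bsub>L\<^esub> t \<in> reciprocal_complement L T"
  unfolding reciprocal_complement_def by (rule generate_ring.incl) auto

text \<open>
  Inverses come from the reciprocal complement: a fraction is the product of an element of \<open>T\<close> and
  a generator of the reciprocal complement.
\<close>

lemma frac_field_subset:
  assumes "subring S L" "T \<subseteq> S" "reciprocal_complement L T \<subseteq> S"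
  shows "carrier (frac_field L T) \<subseteq> S"
proof
  fix x assume "x \<in> carrier (frac_field L T)"
  then obtain a b where "a \<in> T" "b \<in> T" "b \<noteq> \<zero>\<^bsub>L\<^esub>" "x = a \<otimes>\<^bsub>L\<^esub> inv\<^bsub>L\<^esub> b"
    by (auto simp: frac_field_carrier_iff)
  then show "x \<in> S"
    using assms subringE(6)[OF assms(1)] inv_in_reciprocal_complement[of b T L] by blast
qed

section \<open>Finitely generated algebras\<close>

lemma (in ring) subring_adjoin_algebra:
  assumes "K \<subseteq> carrier R" "S \<subseteq> carrier R"
  shows "subring (adjoin_algebra R K S) R"
  unfolding adjoin_algebra_def
  using carrier_is_subring carrier_is_subalgebra[OF assms(1)] assms(2)
  by (intro subring_Inter) auto

lemma (in ring) adjoin_algebra_least: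
  assumes V: "subring V R" "K \<subseteq> V" "S \<subseteq> V"
  shows "adjoin_algebra R K S \<subseteq> V"
proof -
  have "subalgebra K V R"
    using V subringE(6)[OF V(1)] subring.axioms(1)[OF V(1)]
    by (auto simp: subalgebra_def subalgebra_axioms_def)
  then show ?thesis using V unfolding adjoin_algebra_def by auto
qed

lemma adjoin_algebra_incl: "S \<subseteq> adjoin_algebra L K S"
  unfolding adjoin_algebra_def by auto

lemma (in ring) scalars_in_adjoin_algebra:
  assumes "K \<subseteq> carrier R"
  shows "K \<subseteq> adjoin_algebra R K S"
proof
  fix k assume k: "k \<in> K"
  have "k \<in> V" if "subring V R" "subalgebra K V R" for V
    using subalgebra.smult_closed[OF that(2) k subringE(3)[OF that(1)]] k assms by auto
  then show "k \<in> adjoin_algebra R K S" unfolding adjoin_algebra_def by blast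
qed

text \<open>
  The localization of \<open>R(T)\<close> at \<open>inv P\<close> already contains the generators of \<open>T\<close>, each with the
  exponent \<open>1\<close>: \<open>inv P\<close> absorbs the factor \<open>f i\<close> and leaves the reciprocal of an element of \<open>T\<close>.
\<close>

lemma (in field) frac_field_mult_power_in_reciprocal_complement:
  fixes f :: "'i \<Rightarrow> 'a"
  assumes K: "subfield K R" and I: "finite I" and f: "\<And>i. i \<in> I \<Longrightarrow> f i \<in> carrier R - {\<zero>}"
    and T: "T = adjoin_algebra R K (f ` I)"
    and a: "a \<in> carrier (frac_field R T)"
  shows "\<exists>N::nat. a \<otimes> inv (finprod R f I) [^] N \<in> reciprocal_complement R T"
proof -
  have Kc: "K \<subseteq> carrier R" using subringE(1)[OF subfieldE(1)[OF K]] .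
  have subT: "subring T R" unfolding T using Kc f by (intro subring_adjoin_algebra) auto
  have fT: "f i \<in> T" if "i \<in> I" for i
    using adjoin_algebra_incl[of "f ` I" R K] that unfolding T by auto
  have KT: "K \<subseteq> T" unfolding T by (rule scalars_in_adjoin_algebra[OF Kc])
  have prodT: "finprod R f J \<in> T - {\<zero>}" "finprod R f J \<in> carrier R" if "J \<subseteq> I" for J
  proof -
    have "finite J" using that I finite_subset by blast
    then show "finprod R f J \<in> T - {\<zero>}"
      using subring_finprod_closed[OF subT, of J f] finprod_nonzero[of J f] fT f that by blast
    then show "finprod R f J \<in> carrier R" using subringE(1)[OF subT] by auto
  qed
  let ?A = "reciprocal_complement R T"
  let ?g = "inv (finprod R f I)"
  let ?S = "{a \<in> carrier R. \<exists>N::nat. a \<otimes> ?g [^] N \<in> ?A}"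
  note subA = reciprocal_complement_subring(1)[OF subT]
  have gA: "?g \<in> ?A" using prodT(1)[of I] by (intro inv_in_reciprocal_complement) auto
  have gc: "?g \<in> carrier R" using gA subringE(1)[OF subA] by auto
  have subS: "subring ?S R" by (rule localization_is_subring[OF subA gA])
  have AS: "?A \<subseteq> ?S"
  proof
    fix r assume r: "r \<in> ?A"
    then have "r \<in> carrier R" using subringE(1)[OF subA] by auto
    moreover from this r have "r \<otimes> ?g [^] (0::nat) \<in> ?A" by simp
    ultimately show "r \<in> ?S" by blast
  qed
  have "k \<in> ?A" if k: "k \<in> K" for k
  proof (cases "k = \<zero>")
    case True
    then show ?thesis using subringE(2)[OF subA] by simp
  next
    case False
    then have "inv k \<in> T - {\<zero>}" using subfield_m_inv(1)[OF K, of k] k KT by auto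
    then have "inv (inv k) \<in> ?A" by (intro inv_in_reciprocal_complement) auto
    then show ?thesis using inv_nonzero(5)[of k] k False Kc by auto
  qed
  then have KS: "K \<subseteq> ?S" using AS by blast
  have "f i \<in> ?S" if i: "i \<in> I" for i
  proof -
    let ?Q = "finprod R f (I - {i})"
    have fi: "f i \<in> carrier R" "f i \<noteq> \<zero>" using f[OF i] by auto
    have Q: "?Q \<in> carrier R" "?Q \<noteq> \<zero>" "?Q \<in> T" using prodT[of "I - {i}"] by auto
    have "finprod R f (insert i (I - {i})) = f i \<otimes> ?Q"
      using I f fi by (intro finprod_insert) auto
    then have "?g = inv (f i) \<otimes> inv ?Q"
      using i fi Q by (simp add: insert_absorb inv_mult_nonzero)
    moreover have "f i \<otimes> (inv (f i) \<otimes> inv ?Q) = (f i \<otimes> inv (f i)) \<otimes> inv ?Q"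
      using fi(1) inv_nonzero(1)[OF fi] inv_nonzero(1)[OF Q(1,2)] by (simp only: m_assoc)
    moreover have "?g [^] (1::nat) = ?g" using gc by simp
    ultimately have "f i \<otimes> ?g [^] (1::nat) = inv ?Q"
      using inv_nonzero[OF fi] inv_nonzero[OF Q(1,2)] by simp
    then have "f i \<otimes> ?g [^] (1::nat) \<in> ?A"
      using inv_in_reciprocal_complement[of ?Q T R] Q by simp
    then show ?thesis using fi by blast
  qed
  then have "f ` I \<subseteq> ?S" by blast
  then have "T \<subseteq> ?S" unfolding T by (intro adjoin_algebra_least subS[unfolded T] KS[unfolded T])
  then have "carrier (frac_field R T) \<subseteq> ?S" by (rule frac_field_subset[OF subS _ AS])
  then show ?thesis using a by blast
qed

theorem proposition2p9:
  fixes L :: "('a, 'm) ring_scheme" (structure)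
    and K T :: "'a set" and f :: "nat \<Rightarrow> 'a" and n :: nat
  assumes "field L" and "subfield K L"
    and "\<And>i. i \<in> {1..n} \<Longrightarrow> f i \<in> carrier L - {\<zero>}"
    and "T = adjoin_algebra L K (f ` {1..n})"
  shows "generate_ring (frac_field L T)
           (reciprocal_complement L T \<union> {\<Otimes>i\<in>{1..n}. f i}) = carrier (frac_field L T)
       \<and> (\<forall>\<pp>. primeideal \<pp> (L\<lparr>carrier := reciprocal_complement L T\<rparr>) \<and> \<pp> \<noteq> {\<zero>}
             \<longrightarrow> inv (\<Otimes>i\<in>{1..n}. f i) \<in> \<pp>)"
proof -
  interpret field L by (rule assms(1))
  let ?P = "\<Otimes>i\<in>{1..n}. f i"
  let ?A = "reciprocal_complement L T"
  let ?F = "carrier (frac_field L T)"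
  let ?G = "generate_ring (frac_field L T) (?A \<union> {?P})"
  note absorb = frac_field_mult_power_in_reciprocal_complement[OF assms(2) finite_atLeastAtMost
      assms(3) assms(4)]
  have subT: "subring T L"
    unfolding assms(4) using assms(3) subringE(1)[OF subfieldE(1)[OF assms(2)]]
    by (intro subring_adjoin_algebra) auto
  note subF = frac_field_subring[OF subT]
  note subA = reciprocal_complement_subring[OF subT]
  have "f i \<in> T" if "i \<in> {1..n}" for i
    using adjoin_algebra_incl[of "f ` {1..n}" L K] that unfolding assms(4) by auto
  then have PT: "?P \<in> T" by (intro subring_finprod_closed[OF subT]) auto
  have P0: "?P \<noteq> \<zero>" by (rule finprod_nonzero) (use assms(3) in auto)
  have Pc: "?P \<in> carrier L" using PT subringE(1)[OF subT] by auto
  note iP = inv_nonzero[OF Pc P0]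
  have gA: "inv ?P \<in> ?A" by (rule inv_in_reciprocal_complement[OF PT P0])
  have GF: "?G = generate_ring (L\<lparr>carrier := ?F\<rparr>) (?A \<union> {?P})"
    by (subst frac_field_eq) (rule refl)
  have AP: "?A \<union> {?P} \<subseteq> ?F" using subA(2) subset_frac_field[OF subT] PT by auto
  have subG: "subring ?G L" "?G \<subseteq> ?F"
    unfolding GF using generate_ring_in_subring[OF subF AP] by auto
  have "?F \<subseteq> ?G"
  proof
    fix a assume a: "a \<in> ?F"
    then obtain N :: nat where N: "a \<otimes> inv ?P [^] N \<in> ?A" using absorb by blast
    have ac: "a \<in> carrier L" using a subringE(1)[OF subF] by auto
    have "inv ?P [^] N \<otimes> ?P [^] N = \<one>"
      using Pc iP by (simp add: pow_mult_distrib[symmetric])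
    then have "a = (a \<otimes> inv ?P [^] N) \<otimes> ?P [^] N"
      using ac Pc iP by (simp add: m_assoc)
    moreover have "a \<otimes> inv ?P [^] N \<in> ?G" using N by (intro generate_ring.incl) auto
    moreover have "?P [^] N \<in> ?G"
      by (rule subring_nat_pow_closed[OF subG(1)]) (auto intro: generate_ring.incl)
    ultimately show "a \<in> ?G" using subringE(6)[OF subG(1)] by metis
  qed
  with subG(2) have first: "?G = ?F" by blast
  have "inv ?P \<in> \<pp>" if p: "primeideal \<pp> (L\<lparr>carrier := ?A\<rparr>)" and "\<pp> \<noteq> {\<zero>}" for \<pp>
  proof -
    interpret p: primeideal \<pp> "L\<lparr>carrier := ?A\<rparr>" by (rule p)
    have "\<zero> \<in> \<pp>" using p.additive_subgroup_axioms additive_subgroup.zero_closed by fastforce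
    with \<open>\<pp> \<noteq> {\<zero>}\<close> obtain x where x: "x \<in> \<pp>" "x \<noteq> \<zero>" by blast
    have "x \<in> ?A" using p.a_subset x(1) by auto
    then have "x \<in> ?F" using subA(2) by auto
    then obtain a b where ab: "a \<in> T" "b \<in> T" "b \<noteq> \<zero>" "x = a \<otimes> inv b"
      by (auto simp: frac_field_carrier_iff)
    have abc: "a \<in> carrier L" "b \<in> carrier L" using ab subringE(1)[OF subT] by auto
    note ib = inv_nonzero[OF abc(2) ab(3)]
    have a0: "a \<noteq> \<zero>" using x(2) ab(4) ib by auto
    have "inv x = b \<otimes> inv a"
      using ab(4) inv_mult_nonzero[OF abc(1) a0 ib(1,2)] ib inv_nonzero[OF abc(1) a0] abc
      by (simp add: m_comm)
    then have "inv x \<in> ?F" using ab a0 by (auto simp: frac_field_carrier_iff)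
    then obtain N :: nat where "inv x \<otimes> inv ?P [^] N \<in> ?A" using absorb by blast
    then show ?thesis by (rule primeideal_contains_divided_power[OF subA(1) p x gA])
  qed
  with first show ?thesis by blast
qed

end
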